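(* Let $\mathcal{M}=\bigcup_{m\ge 1}\bigcup_{n\ge 1}\mathcal{M}_{m\times n}$ be the set of all real matrices of arbitrary finite dimensions. Then $(\mathcal{M},\ltimes)$, where $\ltimes$ is the semi-tensor product, is a monoid.
   Context: $\mathcal{M}_{m\times n}$ is the set of real $m\times n$ matrices ($m,n\in\mathbb{N}=\{1,2,\dots\}$); $1\times 1$ matrices are identified with real numbers. $\otimes$ is the Kronecker product, $I_k$ the $k\times k$ identity matrix. For $A\in\mathcal{M}_{m\times n}$, $B\in\mathcal{M}_{p\times q}$ and $t=\operatorname{lcm}(n,p)$, the semi-tensor product (M-product) is $A\ltimes B:=(A\otimes I_{t/n})(B\otimes I_{t/p})$. A monoid is a set with an associative binary operation having a two-sided identity element. *)

theory Defs
  imports "Jordan_Normal_Form.Matrix"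
begin

(* Entry ((i,k),(j,l)) of the Kronecker product, A $$ (i,j) * B $$ (k,l), sits (0-based)
   in row i * dim_row B + k and column j * dim_col B + l. *)
definition kronecker :: "'a::times mat \<Rightarrow> 'a mat \<Rightarrow> 'a mat" where
  "kronecker A B =
     mat (dim_row A * dim_row B) (dim_col A * dim_col B)
       (\<lambda>(i, j). A $$ (i div dim_row B, j div dim_col B) * B $$ (i mod dim_row B, j mod dim_col B))"

(* The divisions are exact. *)
definition semi_tensor :: "'a::semiring_1 mat \<Rightarrow> 'a mat \<Rightarrow> 'a mat" where
  "semi_tensor A B =
     (let n = dim_col A; p = dim_row B; t = lcm n p
      in kronecker A (1\<^sub>m (t div n)) * kronecker B (1\<^sub>m (t div p)))"

(* The type mat also contains matrices with no rows or no columns; they are excluded here. *)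
definition all_mats :: "real mat set" where
  "all_mats = (\<Union>m\<in>{1..}. \<Union>n\<in>{1..}. carrier_mat m n)"

end

theory Submission
  imports Defs
begin

text \<open>
  Everything rests on the stretching operation \<open>A \<mapsto> A \<otimes> I\<^sub>s\<close>. For a fixed \<open>s > 0\<close> it is
  multiplicative (\<open>stretch_mult\<close>), and two stretchings compose to one by the product of the
  factors (\<open>stretch_stretch\<close>). Hence both \<open>(A \<ltimes> B) \<ltimes> C\<close> and \<open>A \<ltimes> (B \<ltimes> C)\<close> become ordinary
  products \<open>(A \<otimes> I\<^sub>a) (B \<otimes> I\<^sub>b) (C \<otimes> I\<^sub>c)\<close>, and associativity of \<open>\<ltimes>\<close> reduces to the two
  bracketings giving the same numbers \<open>a\<close>, \<open>b\<close>, \<open>c\<close>.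

  For \<open>A\<close> with \<open>n\<close> columns, \<open>B\<close> of size \<open>p \<times> q\<close> and \<open>C\<close> with \<open>r\<close> rows, conformability forces
  \<open>n a = p b\<close> and \<open>q b = r c\<close>, so \<open>b\<close> determines \<open>a\<close> and \<open>c\<close>. Under either bracketing, the
  multiples of \<open>b\<close> are exactly the numbers \<open>x\<close> with \<open>n dvd p x\<close> and \<open>r dvd q x\<close>
  (\<open>lcm_div_dvd_iff\<close>, applied twice): \<open>b\<close> is the least factor that makes \<open>B\<close> fit on both sides,
  a condition in which the bracketing is not visible.

  The identity element is the \<open>1 \<times> 1\<close> matrix \<open>I\<^sub>1\<close>, since stretching turns it into whichever
  identity matrix the other factor needs.
\<close>

section \<open>Stretching a matrix by an identity matrix\<close>

abbreviation stretch :: "'a::semiring_1 mat \<Rightarrow> nat \<Rightarrow> 'a mat" where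
  "stretch A s \<equiv> kronecker A (1\<^sub>m s)"

lemma dim_stretch [simp]:
  "dim_row (stretch A s) = dim_row A * s" "dim_col (stretch A s) = dim_col A * s"
  by (simp_all add: kronecker_def)

lemma index_stretch:
  assumes "i < dim_row A * s" "j < dim_col A * s"
  shows "stretch A s $$ (i, j) = (if i mod s = j mod s then A $$ (i div s, j div s) else 0)"
proof -
  have "s > 0" using assms by (cases s) auto
  then show ?thesis using assms by (simp add: kronecker_def)
qed

lemma stretch_1 [simp]: "stretch A (Suc 0) = A"
  by (rule eq_matI) (simp_all add: index_stretch)

lemma stretch_one_mat [simp]: "stretch (1\<^sub>m n) s = 1\<^sub>m (n * s)"
proof (rule eq_matI)
  fix i j assume "i < dim_row (1\<^sub>m (n * s))" "j < dim_col (1\<^sub>m (n * s))"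
  moreover have "i = j \<longleftrightarrow> i div s = j div s \<and> i mod s = j mod s"
    by (metis div_mult_mod_eq)
  ultimately show "stretch (1\<^sub>m n) s $$ (i, j) = 1\<^sub>m (n * s) $$ (i, j)"
    by (auto simp: index_stretch less_mult_imp_div_less)
qed simp_all

lemma stretch_stretch: "stretch (stretch A s) r = stretch A (s * r)"
proof (rule eq_matI)
  fix i j assume "i < dim_row (stretch A (s * r))" "j < dim_col (stretch A (s * r))"
  then have i: "i < dim_row A * s * r" and j: "j < dim_col A * s * r"
    by (simp_all add: mult.assoc)
  then have "r > 0" by (cases r) auto
  \<comment> \<open>Residues modulo \<open>s * r\<close> are two-digit numbers in a mixed base, with last digit modulo \<open>r\<close>.\<close>
  have digits: "k mod (s * r) = r * (k div r mod s) + k mod r" for k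
    using mod_mult2_eq[of k r s] by (simp only: mult.commute)
  have last: "k mod (s * r) mod r = k mod r" and first: "k mod (s * r) div r = k div r mod s" for k
    using \<open>r > 0\<close> by (simp_all add: digits)
  have "i mod (s * r) = j mod (s * r) \<longleftrightarrow> i mod r = j mod r \<and> i div r mod s = j div r mod s"
    using digits[of i] digits[of j] last[of i] last[of j] first[of i] first[of j] by auto
  then show "stretch (stretch A s) r $$ (i, j) = stretch A (s * r) $$ (i, j)"
    using i j less_mult_imp_div_less[of i "dim_row A * s" r]
      less_mult_imp_div_less[of j "dim_col A * s" r]
    by (simp add: index_stretch div_mult2_eq mult.assoc flip: mult.commute[of r s])
qed simp_all

text \<open>
  This is the mixed-product rule \<open>(A B) \<otimes> (I\<^sub>s I\<^sub>s) = (A \<otimes> I\<^sub>s) (B \<otimes> I\<^sub>s)\<close>. In row \<open>i\<close> of the right-hand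
  side only those summands survive whose index is congruent to \<open>i\<close> modulo \<open>s\<close>, one for each
  summand on the left.
\<close>
lemma stretch_mult:
  assumes dim: "dim_col A = dim_row B"
  shows "stretch (A * B) s = stretch A s * stretch B s"
proof (rule eq_matI)
  fix i j
  assume "i < dim_row (stretch A s * stretch B s)" "j < dim_col (stretch A s * stretch B s)"
  then have i: "i < dim_row A * s" and j: "j < dim_col B * s" by simp_all
  then have s: "s > 0" by (cases s) auto
  let ?n = "dim_row B"
  let ?f = "\<lambda>k. stretch A s $$ (i, k) * stretch B s $$ (k, j)"
  let ?g = "\<lambda>l. l * s + i mod s"
  have lt: "l * s + i mod s < ?n * s" if "l < ?n" for l
  proof -
    have "l * s + i mod s < Suc l * s" using s by simp
    also have "\<dots> \<le> ?n * s" using that by (intro mult_le_mono1) simp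
    finally show ?thesis .
  qed
  have "(\<Sum>k\<in>{0..<?n * s}. ?f k) = (\<Sum>k\<in>?g ` {0..<?n}. ?f k)"
  proof (rule sum.mono_neutral_right)
    show "?g ` {0..<?n} \<subseteq> {0..<?n * s}" using lt by auto
    show "\<forall>k\<in>{0..<?n * s} - ?g ` {0..<?n}. ?f k = 0"
    proof
      fix k assume k: "k \<in> {0..<?n * s} - ?g ` {0..<?n}"
      have "i mod s \<noteq> k mod s"
      proof
        assume "i mod s = k mod s"
        then have "k = ?g (k div s)" by simp
        with k show False by (auto simp: less_mult_imp_div_less)
      qed
      then show "?f k = 0" using k i dim by (simp add: index_stretch)
    qed
  qed simp
  also have "\<dots> = (\<Sum>l\<in>{0..<?n}. ?f (?g l))"
    using s by (subst sum.reindex) (auto simp: inj_on_def)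
  also have "\<dots> = (\<Sum>l\<in>{0..<?n}. if i mod s = j mod s
      then A $$ (i div s, l) * B $$ (l, j div s) else 0)"
    by (intro sum.cong) (use i j s dim lt in \<open>auto simp: index_stretch\<close>)
  also have "\<dots> = (if i mod s = j mod s then (A * B) $$ (i div s, j div s) else 0)"
    using i j dim by (auto simp: scalar_prod_def less_mult_imp_div_less)
  also have "\<dots> = stretch (A * B) s $$ (i, j)"
    using i j by (simp add: index_stretch)
  finally show "stretch (A * B) s $$ (i, j) = (stretch A s * stretch B s) $$ (i, j)"
    using i j dim by (simp add: scalar_prod_def)
qed simp_all

section \<open>The stretching factors\<close>

lemma lcm_div_pos:
  fixes n p :: nat
  assumes "n > 0" "p > 0"
  shows "lcm n p div n > 0" "lcm n p div p > 0"
  using assms by (simp_all add: div_greater_zero_iff dvd_imp_le lcm_pos_nat)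

text \<open>
  The factor \<open>lcm n p div p\<close> is characterised by its multiples, which makes it possible to
  compare nested least common multiples without computing them.
\<close>
lemma lcm_div_dvd_iff:
  fixes n p x :: nat
  assumes "p > 0"
  shows "lcm n p div p dvd x \<longleftrightarrow> n dvd p * x"
proof -
  have "lcm n p div p dvd x \<longleftrightarrow> p * (lcm n p div p) dvd p * x"
    using assms by (rule nat_mult_dvd_cancel1[symmetric])
  also have "\<dots> \<longleftrightarrow> lcm n p dvd p * x" by simp
  also have "\<dots> \<longleftrightarrow> n dvd p * x" by simp
  finally show ?thesis .
qed

lemma mult_dvd_iff_quotient:
  fixes a b x :: nat
  assumes "a > 0"
  shows "a * b dvd x \<longleftrightarrow> a dvd x \<and> b dvd x div a"
proof (cases "a dvd x")
  case True
  then obtain c where "x = a * c" ..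
  then show ?thesis using assms by simp
next
  case False
  then show ?thesis using dvd_mult_left by blast
qed

text \<open>
  The left-hand side is the factor by which the middle matrix is stretched under the bracketing
  \<open>(A \<ltimes> B) \<ltimes> C\<close>, the right-hand side the one under \<open>A \<ltimes> (B \<ltimes> C)\<close>.
\<close>
lemma middle_factor_eq:
  fixes n p q r :: nat
  assumes pos: "n > 0" "p > 0" "q > 0" "r > 0"
  defines "\<beta> \<equiv> lcm n p div p" and "\<beta>' \<equiv> lcm q r div q"
  shows "\<beta> * (lcm (q * \<beta>) r div (q * \<beta>)) = \<beta>' * (lcm n (p * \<beta>') div (p * \<beta>'))"
    (is "?b = ?b'")
proof -
  have pos': "\<beta> > 0" "\<beta>' > 0"
    using pos by (simp_all only: \<beta>_def \<beta>'_def lcm_div_pos)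
  have \<beta>: "\<beta> dvd x \<longleftrightarrow> n dvd p * x" for x
    using pos by (simp add: \<beta>_def lcm_div_dvd_iff)
  have \<beta>': "\<beta>' dvd x \<longleftrightarrow> r dvd q * x" for x
    unfolding \<beta>'_def lcm.commute[of q] using pos by (intro lcm_div_dvd_iff)
  have b: "?b dvd x \<longleftrightarrow> n dvd p * x \<and> r dvd q * x" for x
  proof -
    have "?b dvd x \<longleftrightarrow> \<beta> dvd x \<and> lcm r (q * \<beta>) div (q * \<beta>) dvd x div \<beta>"
      unfolding lcm.commute[of r] using pos' by (intro mult_dvd_iff_quotient)
    also have "\<dots> \<longleftrightarrow> \<beta> dvd x \<and> r dvd q * \<beta> * (x div \<beta>)"
      using pos pos' by (simp only: lcm_div_dvd_iff nat_0_less_mult_iff simp_thms)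
    finally have "?b dvd x \<longleftrightarrow> \<beta> dvd x \<and> r dvd q * \<beta> * (x div \<beta>)" .
    then show ?thesis by (cases "\<beta> dvd x") (simp_all add: mult.assoc flip: \<beta>)
  qed
  have b': "?b' dvd x \<longleftrightarrow> n dvd p * x \<and> r dvd q * x" for x
  proof -
    have "?b' dvd x \<longleftrightarrow> \<beta>' dvd x \<and> lcm n (p * \<beta>') div (p * \<beta>') dvd x div \<beta>'"
      using pos' by (intro mult_dvd_iff_quotient)
    also have "\<dots> \<longleftrightarrow> \<beta>' dvd x \<and> n dvd p * \<beta>' * (x div \<beta>')"
      using pos pos' by (simp only: lcm_div_dvd_iff nat_0_less_mult_iff simp_thms)
    finally have "?b' dvd x \<longleftrightarrow> \<beta>' dvd x \<and> n dvd p * \<beta>' * (x div \<beta>')" .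
    then show ?thesis by (cases "\<beta>' dvd x") (simp_all add: mult.assoc flip: \<beta>')
  qed
  show ?thesis using b[of ?b] b[of ?b'] b'[of ?b] b'[of ?b'] by (intro dvd_antisym) simp_all
qed

section \<open>The semi-tensor product\<close>

lemma semi_tensor_eq:
  "semi_tensor A B = stretch A (lcm (dim_col A) (dim_row B) div dim_col A) *
     stretch B (lcm (dim_col A) (dim_row B) div dim_row B)"
  by (simp add: semi_tensor_def Let_def)

lemma dim_semi_tensor:
  "dim_row (semi_tensor A B) = dim_row A * (lcm (dim_col A) (dim_row B) div dim_col A)"
  "dim_col (semi_tensor A B) = dim_col B * (lcm (dim_col A) (dim_row B) div dim_row B)"
  by (simp_all add: semi_tensor_eq)

lemma semi_tensor_assoc:
  assumes pos: "dim_col A > 0" "dim_row B > 0" "dim_col B > 0" "dim_row C > 0"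
  shows "semi_tensor (semi_tensor A B) C = semi_tensor A (semi_tensor B C)"
proof -
  define n p q r where "n = dim_col A" and "p = dim_row B" and "q = dim_col B"
    and "r = dim_row C"
  note npqr = this
  define \<alpha> \<beta> where "\<alpha> = lcm n p div n" and "\<beta> = lcm n p div p"
  define \<beta>' \<gamma>' where "\<beta>' = lcm q r div q" and "\<gamma>' = lcm q r div r"
  define y z where "y = lcm (q * \<beta>) r div (q * \<beta>)" and "z = lcm (q * \<beta>) r div r"
  define x' y' where "x' = lcm n (p * \<beta>') div n" and "y' = lcm n (p * \<beta>') div (p * \<beta>')"
  have AB: "n * \<alpha> = p * \<beta>" and BC: "q * \<beta>' = r * \<gamma>'"
    and AB_C: "q * \<beta> * y = r * z" and A_BC: "n * x' = p * \<beta>' * y'"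
    by (simp_all add: \<alpha>_def \<beta>_def \<beta>'_def \<gamma>'_def y_def z_def x'_def y'_def)
  have mid: "\<beta> * y = \<beta>' * y'"
    using middle_factor_eq[of n p q r] pos
    by (simp add: npqr \<beta>_def \<beta>'_def y_def y'_def)
  have "n * (\<alpha> * y) = p * (\<beta> * y)"
    by (simp only: AB flip: mult.assoc)
  also have "\<dots> = n * x'"
    by (simp only: mid A_BC mult.assoc)
  finally have left: "\<alpha> * y = x'" using pos by (simp add: npqr)
  have "r * (\<gamma>' * y') = q * (\<beta>' * y')"
    by (simp only: BC flip: mult.assoc)
  also have "\<dots> = r * z"
    by (simp only: AB_C flip: mid mult.assoc)
  finally have right: "\<gamma>' * y' = z" using pos by (simp add: npqr)
  have "semi_tensor (semi_tensor A B) C = stretch (stretch A \<alpha> * stretch B \<beta>) y * stretch C z"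
    unfolding semi_tensor_eq[of "semi_tensor A B"] dim_semi_tensor
    by (simp add: semi_tensor_eq npqr \<alpha>_def \<beta>_def y_def z_def)
  also have "\<dots> = (stretch A (\<alpha> * y) * stretch B (\<beta> * y)) * stretch C z"
    using AB by (simp add: stretch_mult stretch_stretch npqr)
  also have "\<dots> = stretch A (\<alpha> * y) * (stretch B (\<beta> * y) * stretch C z)"
    using AB AB_C by (intro assoc_mult_mat) (auto simp: npqr mult.assoc[symmetric])
  also have "\<dots> = stretch A x' * (stretch B (\<beta>' * y') * stretch C (\<gamma>' * y'))"
    by (simp only: left mid right)
  also have "\<dots> = stretch A x' * stretch (stretch B \<beta>' * stretch C \<gamma>') y'"
    using BC by (simp add: stretch_mult stretch_stretch npqr)
  also have "\<dots> = semi_tensor A (semi_tensor B C)"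
    unfolding semi_tensor_eq[of A] dim_semi_tensor
    by (simp add: semi_tensor_eq npqr \<beta>'_def \<gamma>'_def x'_def y'_def)
  finally show ?thesis .
qed

lemma semi_tensor_one_left:
  assumes "dim_row A > 0"
  shows "semi_tensor (1\<^sub>m 1) A = A"
  using assms by (simp add: semi_tensor_eq)

lemma semi_tensor_one_right:
  assumes "dim_col A > 0"
  shows "semi_tensor A (1\<^sub>m 1) = A"
  using assms by (simp add: semi_tensor_eq)

lemma all_mats_iff: "A \<in> all_mats \<longleftrightarrow> dim_row A > 0 \<and> dim_col A > 0"
proof
  assume "A \<in> all_mats"
  then show "dim_row A > 0 \<and> dim_col A > 0"
    by (fastforce simp: all_mats_def)
next
  assume "dim_row A > 0 \<and> dim_col A > 0"
  then have "dim_row A \<in> {1..}" "dim_col A \<in> {1..}" by simp_all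
  moreover have "A \<in> carrier_mat (dim_row A) (dim_col A)" by simp
  ultimately show "A \<in> all_mats" unfolding all_mats_def by blast
qed

lemma semi_tensor_closed:
  assumes "A \<in> all_mats" "B \<in> all_mats"
  shows "semi_tensor A B \<in> all_mats"
  using assms by (simp add: all_mats_iff dim_semi_tensor lcm_div_pos)

theorem mainTheorem1:
  shows "\<exists>e. monoid \<lparr>carrier = all_mats, mult = semi_tensor, one = e\<rparr>"
proof
  show "monoid \<lparr>carrier = all_mats, mult = semi_tensor, one = 1\<^sub>m 1\<rparr>"
  proof (rule monoidI, unfold monoid.simps partial_object.simps)
    show "1\<^sub>m 1 \<in> all_mats" by (simp add: all_mats_iff)
  next
    fix A B assume "A \<in> all_mats" "B \<in> all_mats"
    then show "semi_tensor A B \<in> all_mats" by (rule semi_tensor_closed)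
  next
    fix A B C assume "A \<in> all_mats" "B \<in> all_mats" "C \<in> all_mats"
    then show "semi_tensor (semi_tensor A B) C = semi_tensor A (semi_tensor B C)"
      by (intro semi_tensor_assoc) (simp_all add: all_mats_iff)
  next
    fix A assume "A \<in> all_mats"
    then show "semi_tensor (1\<^sub>m 1) A = A" and "semi_tensor A (1\<^sub>m 1) = A"
      by (simp_all only: all_mats_iff semi_tensor_one_left semi_tensor_one_right)
  qed
qed

end
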